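(* Let $N=(G,f)$ be a Boolean network and $(I_1,\ldots,I_k)$ an ordered partition of $V(G)$ into non-empty sets such that for all $i<j$, $G$ has no directed path from a vertex of $I_j$ to a vertex of $I_i$ (for instance, the vertex sets of the strongly connected components of $G$ listed along a linear extension of the order of the condensation). Define $N_1=N[I_1]$, $N_i^{a_1,\ldots,a_{i-1}}=N(I_1,a_1)\cdots(I_{i-1},a_{i-1})[I_i]$ for $1<i<k$, and $N_k^{a_1,\ldots,a_{k-1}}=N(I_1,a_1)\cdots(I_{k-1},a_{k-1})$. Then $\mathcal{A}(N)$ is the set of Cartesian products $a_1\times\cdots\times a_k$ (identifying $\{0,1\}^{V(G)}$ with $\prod_i\{0,1\}^{I_i}$) such that $a_1\in\mathcal{A}(N_1)$ and $a_i\in\mathcal{A}(N_i^{a_1,\ldots,a_{i-1}})$ for $2\le i\le k$. Consequently $\mathcal{A}(N)$ is in bijection with the dependent sum $$\sum_{a_1\in\mathcal{A}(N_1)}\ \sum_{a_2\in\mathcal{A}(N_2^{a_1})}\cdots\sum_{a_{k-1}\in\mathcal{A}(N_{k-1}^{a_1,\ldots,a_{k-2}})}\mathcal{A}(N_k^{a_1,\ldots,a_{k-1}}).$$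
   Context: Let $\mathbb{B}=\{0,1\}$. A Boolean network is a pair $N=(G,f)$ where $G$ is a finite directed graph and $f=(f_v)_{v\in V(G)}$ with $f_v:\mathbb{B}^{G^-(v)}\to\mathbb{B}$, $G^-(v)$ the in-neighbourhood of $v$. $\mathrm{ASTG}(N)$ has vertex set $\mathbb{B}^{V(G)}$ and an edge from $x$ to $y$ iff $x,y$ differ in exactly one coordinate $v$ and $f_v(x\restriction G^-(v))=y_v\neq x_v$; networks on a given vertex set are identified with such partial orientations. Attractors of $N$ are the terminal strongly connected components of $\mathrm{ASTG}(N)$ (as sets of states); $\mathcal{A}(N)$ is the set of attractors. For $J$ closed under in-neighbours, $N[J]=(G[J],(f_v)_{v\in J})$. For $I\subseteq V(G)$ with no edge from $V(G)\setminus I$ to $I$, $x\in\mathbb{B}^I$, $v\notin I$: $f^x_v(y)=f_v(z)$ where $z\in\mathbb{B}^{G^-(v)}$ agrees with $x$ on $G^-(v)\cap I$ and with $y$ on $G^-(v)\setminus I$; $N(I,x)=(G[V(G)\setminus I],(f^x_v)_{v\notin I})$; for $a\subseteq\mathbb{B}^I$, $N(I,a)$ is the network on $V(G)\setminus I$ whose ASTG is the edge union of the $\mathrm{ASTG}(N(I,x))$, $x\in a$. Iterated expressions like $N(I_1,a_1)(I_2,a_2)$ apply these constructions successively (to the network $N(I_1,a_1)$ on $I_2\cup\cdots\cup I_k$ with the set $I_2$, etc.). *)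

theory Defs
  imports "Graph_Theory.Graph_Theory" "HOL-Library.FuncSet" "HOL-Library.Disjoint_Sets"
begin

text \<open>
  \<open>update N v\<close> is only ever applied to states restricted to the in-neighbourhood of \<open>v\<close>, so
  it represents a map from \<open>{0,1}\<close>-assignments on that in-neighbourhood to \<open>{0,1}\<close>.
  Partial assignments are functions that are \<open>undefined\<close> off their domain.
\<close>

record 'v network =
  net_graph :: "'v pair_pre_digraph"
  update :: "'v \<Rightarrow> ('v \<Rightarrow> bool) \<Rightarrow> bool"

abbreviation nodes :: "'v network \<Rightarrow> 'v set" where
  "nodes N \<equiv> pverts (net_graph N)"

definition in_nbrs :: "'v pair_pre_digraph \<Rightarrow> 'v \<Rightarrow> 'v set" where
  "in_nbrs G v = {u. (u, v) \<in> parcs G}"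

definition states :: "'v set \<Rightarrow> ('v \<Rightarrow> bool) set" where
  "states V = (V \<rightarrow>\<^sub>E UNIV)"

definition local_update :: "'v network \<Rightarrow> 'v \<Rightarrow> ('v \<Rightarrow> bool) \<Rightarrow> bool" where
  "local_update N v x = update N v (restrict x (in_nbrs (net_graph N) v))"

definition ASTG :: "'v network \<Rightarrow> ('v \<Rightarrow> bool) pair_pre_digraph" where
  "ASTG N =
    \<lparr> pverts = states (nodes N),
      parcs = {(x, y). x \<in> states (nodes N) \<and> y \<in> states (nodes N) \<and>
                (\<exists>v. {u \<in> nodes N. x u \<noteq> y u} = {v} \<and> local_update N v x = y v)} \<rparr>"

definition attractors :: "'v network \<Rightarrow> ('v \<Rightarrow> bool) set set" where
  "attractors N =
    {A \<in> pre_digraph.sccs_verts (with_proj (ASTG N)).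
       \<forall>x y. x \<in> A \<longrightarrow> (x, y) \<in> parcs (ASTG N) \<longrightarrow> y \<in> A}"

definition pair_induce :: "'v pair_pre_digraph \<Rightarrow> 'v set \<Rightarrow> 'v pair_pre_digraph" where
  "pair_induce G J = \<lparr> pverts = J, parcs = {(u, v) \<in> parcs G. u \<in> J \<and> v \<in> J} \<rparr>"

lemma with_proj_pair_induce: "with_proj (pair_induce G J) = with_proj G \<restriction> J"
  by (auto simp: pair_induce_def with_proj_def induce_subgraph_def)

text \<open>\<open>N[J]\<close>, for \<open>J\<close> closed under in-neighbours.\<close>

definition subnetwork :: "'v network \<Rightarrow> 'v set \<Rightarrow> 'v network" where
  "subnetwork N J = \<lparr> net_graph = pair_induce (net_graph N) J, update = update N \<rparr>"

text \<open>\<open>N(I,x)\<close>, for a single assignment \<open>x\<close> on \<open>I\<close>.\<close>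

definition fix_state :: "'v network \<Rightarrow> 'v set \<Rightarrow> ('v \<Rightarrow> bool) \<Rightarrow> 'v network" where
  "fix_state N I x =
    \<lparr> net_graph = pair_induce (net_graph N) (nodes N - I),
      update = (\<lambda>v y. update N v
        (restrict (\<lambda>u. if u \<in> I then x u else y u) (in_nbrs (net_graph N) v))) \<rparr>"

text \<open>
  \<open>N(I,a)\<close>, for a set \<open>a\<close> of assignments on \<open>I\<close>, is determined by its ASTG being the edge union
  of those of \<open>N(I,x)\<close>, \<open>x \<in> a\<close> (\<open>ASTG_fix_states\<close> below). Different \<open>x\<close> may disagree on the
  target value of \<open>v\<close>; then both orientations of an edge in direction \<open>v\<close> can occur, and the
  update function of \<open>v\<close> depends on \<open>v\<close> itself. Hence the loops added to the induced graph.
\<close>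

definition fix_states :: "'v network \<Rightarrow> 'v set \<Rightarrow> ('v \<Rightarrow> bool) set \<Rightarrow> 'v network" where
  "fix_states N I a =
    \<lparr> net_graph = \<lparr> pverts = nodes N - I,
                parcs = parcs (pair_induce (net_graph N) (nodes N - I)) \<union> Id_on (nodes N - I) \<rparr>,
      update = (\<lambda>v y. if \<exists>x\<in>a. local_update (fix_state N I x) v y \<noteq> y v
                       then \<not> y v else y v) \<rparr>"

lemma local_update_fix_states:
  assumes "v \<in> nodes N - I"
  shows "local_update (fix_states N I a) v y =
    (if \<exists>x\<in>a. local_update (fix_state N I x) v y \<noteq> y v then \<not> y v else y v)"
proof -
  let ?S = "in_nbrs (net_graph (fix_states N I a)) v"
  have v: "v \<in> ?S"
    using assms by (auto simp: in_nbrs_def fix_states_def)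
  have "in_nbrs (net_graph (fix_state N I x)) v \<subseteq> ?S" for x
    by (auto simp: in_nbrs_def fix_states_def fix_state_def)
  then have "local_update (fix_state N I x) v (restrict y ?S) = local_update (fix_state N I x) v y"
    for x
    by (simp add: local_update_def Int_absorb1)
  with v show ?thesis
    by (simp add: local_update_def[of "fix_states N I a"]) (simp add: fix_states_def)
qed

lemma ASTG_fix_states:
  "pverts (ASTG (fix_states N I a)) = states (nodes N - I)"
  "parcs (ASTG (fix_states N I a)) = (\<Union>x\<in>a. parcs (ASTG (fix_state N I x)))"
proof -
  have n: "nodes (fix_states N I a) = nodes N - I" "nodes (fix_state N I x) = nodes N - I" for x
    by (simp_all add: fix_states_def fix_state_def pair_induce_def)
  show "pverts (ASTG (fix_states N I a)) = states (nodes N - I)"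
    by (simp add: ASTG_def n)
  define D where "D = (\<lambda>(y :: _ \<Rightarrow> bool) z. {u \<in> nodes N - I. y u \<noteq> z u})"
  have *: "local_update (fix_states N I a) v y = z v \<longleftrightarrow>
      (\<exists>x\<in>a. local_update (fix_state N I x) v y = z v)" if "D y z = {v}" for v y z
  proof -
    have "v \<in> D y z" using that by simp
    then have "v \<in> nodes N - I" "y v \<noteq> z v" by (auto simp: D_def)
    then show ?thesis by (auto simp: local_update_fix_states)
  qed
  have "(\<exists>v. D y z = {v} \<and> local_update (fix_states N I a) v y = z v) \<longleftrightarrow>
      (\<exists>x\<in>a. \<exists>v. D y z = {v} \<and> local_update (fix_state N I x) v y = z v)" for y z
    by (simp add: * cong: conj_cong) blast
  then show "parcs (ASTG (fix_states N I a)) = (\<Union>x\<in>a. parcs (ASTG (fix_state N I x)))"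
    unfolding ASTG_def n pair_pre_digraph.simps D_def[symmetric, THEN fun_cong, THEN fun_cong]
    by auto
qed

text \<open>\<open>N(I\<^sub>1,a\<^sub>1)(I\<^sub>2,a\<^sub>2)\<dots>\<close>, where the list of the \<open>a\<^sub>i\<close> may be shorter than that of the \<open>I\<^sub>i\<close>.\<close>

definition fix_layers ::
  "'v network \<Rightarrow> 'v set list \<Rightarrow> ('v \<Rightarrow> bool) set list \<Rightarrow> 'v network" where
  "fix_layers N Is as = foldl (\<lambda>M (I, a). fix_states M I a) N (zip Is as)"

text \<open>
  \<open>layer_network N Is [a\<^sub>1, \<dots>, a\<^bsub>i-1\<^esub>]\<close> is the network \<open>N\<^sub>i\<close> with superscript
  \<open>a\<^sub>1, \<dots>, a\<^bsub>i-1\<^esub>\<close>; as lists are indexed from 0, its node set \<open>I\<^sub>i\<close> is \<open>Is ! (i - 1)\<close>.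
\<close>

definition layer_network ::
  "'v network \<Rightarrow> 'v set list \<Rightarrow> ('v \<Rightarrow> bool) set list \<Rightarrow> 'v network" where
  "layer_network N Is as =
    (if length as = 0 then subnetwork N (Is ! 0)
     else if length as < length Is - 1 then subnetwork (fix_layers N Is as) (Is ! length as)
     else fix_layers N Is as)"

text \<open>
  The product \<open>a\<^sub>1 \<times> \<dots> \<times> a\<^sub>k\<close> as a set of states on the union of the \<open>I\<^sub>i\<close>, a state being
  identified with the tuple of its restrictions to the \<open>I\<^sub>i\<close>.
\<close>

definition layer_product ::
  "'v set list \<Rightarrow> ('v \<Rightarrow> bool) set list \<Rightarrow> ('v \<Rightarrow> bool) set" where
  "layer_product Is as =
    {x \<in> states (\<Union> (set Is)). \<forall>i < length Is. restrict x (Is ! i) \<in> as ! i}"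

text \<open>
  The \<open>k\<close>-fold dependent sum of \<open>F []\<close>, \<open>F [a\<^sub>1]\<close>, \<open>F [a\<^sub>1, a\<^sub>2]\<close>, \<dots>,
  with nested pairs flattened to lists.
\<close>

primrec dependent_sum :: "nat \<Rightarrow> ('b list \<Rightarrow> 'b set) \<Rightarrow> 'b list set" where
  "dependent_sum 0 F = {[]}"
| "dependent_sum (Suc k) F =
    (\<lambda>(a, as). a # as) ` (SIGMA a : F []. dependent_sum k (\<lambda>as. F (a # as)))"

end

theory Submission
  imports Defs
begin

text \<open>
  Split the nodes into a set \<open>I\<close> closed under in-neighbours and its complement. A transition
  of \<open>N\<close> either moves the \<open>I\<close>-part of the state along a transition of \<open>N[I]\<close>, whatever the rest
  of the state is, or moves the rest along a transition of \<open>N(I,x)\<close>, where \<open>x\<close> is the current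
  \<open>I\<close>-part. Inside an attractor \<open>A\<close> of \<open>N\<close> the \<open>I\<close>-part can therefore be moved freely through
  the projection \<open>a\<close> of \<open>A\<close>, so \<open>A\<close> is a product \<open>a \<times> b\<close>; and any transition of \<open>N(I,a)\<close>, being
  one of some \<open>N(I,x)\<close> with \<open>x \<in> a\<close>, is available after first moving the \<open>I\<close>-part to \<open>x\<close>.
  Thus the attractors of \<open>N\<close> are the products of an attractor \<open>a\<close> of \<open>N[I]\<close> and an attractor of
  \<open>N(I,a)\<close>, and the theorem follows by induction on the number of layers.
\<close>

section \<open>Transitions and attractors of a network\<close>

abbreviation transitions :: "'v network \<Rightarrow> (('v \<Rightarrow> bool) \<times> ('v \<Rightarrow> bool)) set" where
  "transitions N \<equiv> parcs (ASTG N)"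

lemma states_fun_upd: "x \<in> states V \<Longrightarrow> v \<in> V \<Longrightarrow> x(v := b) \<in> states V"
  by (auto simp: states_def PiE_iff extensional_def)

lemma restrict_in_states: "restrict x V \<in> states V"
  by (simp add: states_def)

lemma states_eqI: "x \<in> states V \<Longrightarrow> y \<in> states V \<Longrightarrow> (\<And>u. u \<in> V \<Longrightarrow> x u = y u) \<Longrightarrow> x = y"
  unfolding states_def by (rule PiE_ext)

text \<open>Over two values, the coordinate in which \<open>y\<close> differs determines
  \<open>y\<close>: it is \<open>x\<close> with that coordinate negated. A transition thus amounts
  to a node whose update disagrees with its current value, which is the form used for splitting node
  sets.\<close>

lemma transitions_iff:
  "(x, y) \<in> transitions N \<longleftrightarrow>
    x \<in> states (nodes N) \<and> (\<exists>v\<in>nodes N. local_update N v x \<noteq> x v \<and> y = x(v := \<not> x v))"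
    (is "?L \<longleftrightarrow> ?R")
proof
  assume ?L
  then obtain v where x: "x \<in> states (nodes N)" and y: "y \<in> states (nodes N)"
    and v: "{u \<in> nodes N. x u \<noteq> y u} = {v}" and "local_update N v x = y v"
    by (auto simp: ASTG_def)
  moreover from v have "v \<in> nodes N" "y v = (\<not> x v)" by auto
  \<comment> \<open>Both sides are \<open>undefined\<close> off the nodes, so agreement on the nodes
    gives equality of functions.\<close>
  moreover have "y = x(v := \<not> x v)"
  proof (rule states_eqI[OF y])
    show "x(v := \<not> x v) \<in> states (nodes N)"
      using x \<open>v \<in> nodes N\<close> by (rule states_fun_upd)
    show "y u = (x(v := \<not> x v)) u" if "u \<in> nodes N" for u
      using that v \<open>y v = (\<not> x v)\<close> by auto
  qed
  ultimately show ?R by auto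
next
  assume ?R
  then obtain v where "x \<in> states (nodes N)" "v \<in> nodes N" "local_update N v x \<noteq> x v"
    "y = x(v := \<not> x v)" by blast
  moreover from this have "{u \<in> nodes N. x u \<noteq> y u} = {v}" by auto
  ultimately show ?L by (auto simp: ASTG_def intro: states_fun_upd)
qed

lemma transitions_in_states:
  assumes "(x, y) \<in> transitions N"
  shows "x \<in> states (nodes N)" "y \<in> states (nodes N)"
  using assms by (auto simp: ASTG_def)

text \<open>Library reachability is confined to the vertex set. Transitions never leave the states,
  so only the starting point has to be checked.\<close>

lemma reachable_ASTG_iff:
  "x \<rightarrow>\<^sup>*\<^bsub>with_proj (ASTG N)\<^esub> y \<longleftrightarrow> x \<in> states (nodes N) \<and> (x, y) \<in> (transitions N)\<^sup>*"
proof -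
  have "y \<in> states (nodes N)" if "(x, y) \<in> (transitions N)\<^sup>*" "x \<in> states (nodes N)"
    using that by induction (auto dest: transitions_in_states)
  moreover have "pverts (ASTG N) = states (nodes N)"
    by (simp add: ASTG_def)
  ultimately show ?thesis
    unfolding reachable_def with_proj_simps
    by (auto dest: in_rtrancl_on_in_F rtrancl_on_rtranclI transitions_in_states
        intro: rtrancl_consistent_rtrancl_on)
qed

text \<open>Maximality of a strongly connected component disappears here: a set closed under
  transitions contains everything reachable from it, so no larger set can be strongly
  connected.\<close>

lemma attractors_iff:
  "A \<in> attractors N \<longleftrightarrow>
    A \<noteq> {} \<and> A \<subseteq> states (nodes N) \<and>
    (\<forall>x\<in>A. \<forall>y\<in>A. (x, y) \<in> (transitions N)\<^sup>*) \<and>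
    (\<forall>x\<in>A. \<forall>y. (x, y) \<in> transitions N \<longrightarrow> y \<in> A)"
proof -
  have "y \<in> A" if "\<forall>x\<in>A. \<forall>y. (x, y) \<in> transitions N \<longrightarrow> y \<in> A"
    "(x, y) \<in> (transitions N)\<^sup>*" "x \<in> A" for x y
    using that(2,3) by induction (use that(1) in auto)
  then show ?thesis
    unfolding attractors_def pre_digraph.sccs_verts_def reachable_ASTG_iff by blast
qed

lemma attractors_nonempty: "A \<in> attractors N \<Longrightarrow> A \<noteq> {}"
  and attractors_subset_states: "A \<in> attractors N \<Longrightarrow> A \<subseteq> states (nodes N)"
  and attractors_connected:
    "A \<in> attractors N \<Longrightarrow> x \<in> A \<Longrightarrow> y \<in> A \<Longrightarrow> (x, y) \<in> (transitions N)\<^sup>*"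
  and attractors_closed:
    "A \<in> attractors N \<Longrightarrow> x \<in> A \<Longrightarrow> (x, y) \<in> transitions N \<Longrightarrow> y \<in> A"
  by (simp_all add: attractors_iff)

text \<open>Base case of the induction over layers: the everywhere \<open>undefined\<close> function
  is the only state, and it has no transition.\<close>

lemma attractors_no_nodes:
  assumes "nodes N = {}"
  shows "attractors N = {states {}}"
proof -
  have "states {} = {\<lambda>_. undefined}" by (simp add: states_def)
  then have "A \<in> attractors N \<longleftrightarrow> A = states {}" for A
    using assms unfolding attractors_iff transitions_iff by (auto simp: subset_singleton_iff)
  then show ?thesis by blast
qed

section \<open>Derived networks and products of sets of states\<close>

lemma nodes_subnetwork [simp]: "nodes (subnetwork N J) = J"
  by (simp add: subnetwork_def pair_induce_def)

lemma nodes_fix_state [simp]: "nodes (fix_state N I x) = nodes N - I"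
  by (simp add: fix_state_def pair_induce_def)

lemma nodes_fix_states [simp]: "nodes (fix_states N I a) = nodes N - I"
  by (simp add: fix_states_def)

text \<open>Reconciles the last layer, which is defined without an induced subnetwork, with the
  first layer, which is defined with one. Well-formedness ensures that inducing on all nodes loses
  no arc.\<close>

lemma subnetwork_nodes:
  assumes "pair_wf_digraph (net_graph N)"
  shows "subnetwork N (nodes N) = N"
proof -
  have "{(u, v) \<in> parcs (net_graph N). u \<in> nodes N \<and> v \<in> nodes N} = parcs (net_graph N)"
    using pair_wf_digraph.in_arcsD1[OF assms] pair_wf_digraph.in_arcsD2[OF assms] by auto
  then show ?thesis
    by (simp add: subnetwork_def pair_induce_def)
qed

lemma pair_wf_digraph_fix_states: "pair_wf_digraph (net_graph (fix_states N I a))"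
  by unfold_locales (auto simp: fix_states_def pair_induce_def)

text \<open>The inverse of splitting a state into its two restrictions. Outside the whole node set
  the value is that of \<open>y\<close>, hence \<open>undefined\<close> for a state \<open>y\<close>
  on the complement of \<open>I\<close>.\<close>

definition glue :: "'v set \<Rightarrow> ('v \<Rightarrow> bool) \<Rightarrow> ('v \<Rightarrow> bool) \<Rightarrow> 'v \<Rightarrow> bool" where
  "glue I x y = (\<lambda>u. if u \<in> I then x u else y u)"

text \<open>The Cartesian product of \<open>a\<close> and \<open>b\<close>, a state on
  \<open>V\<close> being identified with the pair of its restrictions.\<close>

definition state_product ::
  "'v set \<Rightarrow> 'v set \<Rightarrow> ('v \<Rightarrow> bool) set \<Rightarrow> ('v \<Rightarrow> bool) set \<Rightarrow> ('v \<Rightarrow> bool) set" where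
  "state_product V I a b = {z \<in> states V. restrict z I \<in> a \<and> restrict z (V - I) \<in> b}"

lemma
  assumes "I \<subseteq> V" "x \<in> states I" "y \<in> states (V - I)"
  shows glue_in_states: "glue I x y \<in> states V"
    and restrict_glue_lower: "restrict (glue I x y) I = x"
    and restrict_glue_upper: "restrict (glue I x y) (V - I) = y"
  using assms by (auto simp: states_def PiE_iff extensional_def glue_def restrict_def)

lemma glue_restrict:
  assumes "z \<in> states V"
  shows "glue I (restrict z I) (restrict z (V - I)) = z"
  using assms by (auto simp: states_def PiE_iff extensional_def glue_def restrict_def)

text \<open>A product determines its factors, because any \<open>x\<close> in \<open>a\<close> and
  \<open>y\<close> in \<open>b\<close> can be glued. Both factors must be non-empty to supply a
  partner for the element of the other factor.\<close>

lemma state_product_projections: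
  assumes "I \<subseteq> V" "a \<subseteq> states I" "b \<subseteq> states (V - I)" "a \<noteq> {}" "b \<noteq> {}"
  shows "(\<lambda>z. restrict z I) ` state_product V I a b = a"
    and "(\<lambda>z. restrict z (V - I)) ` state_product V I a b = b"
proof -
  have g: "glue I x y \<in> state_product V I a b" "restrict (glue I x y) I = x"
    "restrict (glue I x y) (V - I) = y" if "x \<in> a" "y \<in> b" for x y
  proof -
    have st: "x \<in> states I" "y \<in> states (V - I)" using that assms by auto
    then show lower: "restrict (glue I x y) I = x" and upper: "restrict (glue I x y) (V - I) = y"
      by (rule restrict_glue_lower[OF assms(1)], rule restrict_glue_upper[OF assms(1)])
    show "glue I x y \<in> state_product V I a b"
      unfolding state_product_def mem_Collect_eq lower upper
      using glue_in_states[OF assms(1) st] that by blast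
  qed
  obtain x\<^sub>0 y\<^sub>0 where "x\<^sub>0 \<in> a" "y\<^sub>0 \<in> b" using assms by blast
  then have "x \<in> (\<lambda>z. restrict z I) ` state_product V I a b" if "x \<in> a" for x
    using g[OF that \<open>y\<^sub>0 \<in> b\<close>] by (metis imageI)
  moreover have "y \<in> (\<lambda>z. restrict z (V - I)) ` state_product V I a b" if "y \<in> b" for y
    using g[OF \<open>x\<^sub>0 \<in> a\<close> that] by (metis imageI)
  ultimately show "(\<lambda>z. restrict z I) ` state_product V I a b = a"
    and "(\<lambda>z. restrict z (V - I)) ` state_product V I a b = b"
    by (auto simp: state_product_def)
qed

section \<open>Splitting transitions along a set closed under in-neighbours\<close>

locale lower_layer =
  fixes N :: "'v network" and I :: "'v set"
  assumes wf: "pair_wf_digraph (net_graph N)"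
    and lower_subset: "I \<subseteq> nodes N"
    and lower_closed: "(u, v) \<in> parcs (net_graph N) \<Longrightarrow> v \<in> I \<Longrightarrow> u \<in> I"
begin

abbreviation "J \<equiv> nodes N - I"

text \<open>All inputs of a node in \<open>I\<close> lie in \<open>I\<close>, so the rest of the
  state is invisible to it.\<close>

lemma local_update_subnetwork:
  assumes "v \<in> I"
  shows "local_update (subnetwork N I) v (restrict z I) = local_update N v z"
proof -
  have "in_nbrs (pair_induce (net_graph N) I) v = in_nbrs (net_graph N) v"
    "in_nbrs (net_graph N) v \<subseteq> I"
    using assms lower_closed by (auto simp: in_nbrs_def pair_induce_def)
  then show ?thesis
    by (simp add: local_update_def subnetwork_def Int_absorb1)
qed

text \<open>Inputs in \<open>I\<close> are read from the fixed assignment. The others lie in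
  \<open>J\<close> because arcs join nodes, so \<open>v\<close> sees exactly the inputs it has in
  \<open>z\<close>.\<close>

lemma local_update_fix_state:
  assumes "v \<in> J"
  shows "local_update (fix_state N I (restrict z I)) v (restrict z J) = local_update N v z"
proof -
  have "u \<in> in_nbrs (pair_induce (net_graph N) J) v" "u \<in> J"
    if "u \<in> in_nbrs (net_graph N) v" "u \<notin> I" for u
    using that assms pair_wf_digraph.in_arcsD1[OF wf] by (auto simp: in_nbrs_def pair_induce_def)
  then show ?thesis
    by (auto simp: local_update_def fix_state_def restrict_def
        intro!: arg_cong[where f = "update N v"])
qed

text \<open>A transition flips one node, which is either in \<open>I\<close> or in \<open>J\<close>.
  The other restriction stays put, and the two preceding lemmas identify the update.\<close>

lemma transitions_decompose:
  assumes "z \<in> states (nodes N)" "z' \<in> states (nodes N)"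
  shows "(z, z') \<in> transitions N \<longleftrightarrow>
    (restrict z I, restrict z' I) \<in> transitions (subnetwork N I) \<and> restrict z J = restrict z' J \<or>
    restrict z I = restrict z' I \<and>
      (restrict z J, restrict z' J) \<in> transitions (fix_state N I (restrict z I))"
    (is "_ \<longleftrightarrow> ?low \<or> ?high")
proof -
  \<comment> \<open>A state is recovered by gluing its two restrictions.\<close>
  have eq: "z' = w \<longleftrightarrow> restrict z' I = restrict w I \<and> restrict z' J = restrict w J"
    if "w \<in> states (nodes N)" for w
    using glue_restrict[OF assms(2), of I] glue_restrict[OF that, of I] by metis
  have low: "z' = z(v := \<not> z v) \<longleftrightarrow>
      restrict z' I = (restrict z I)(v := \<not> z v) \<and> restrict z J = restrict z' J"
    if "v \<in> I" for v
  proof -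
    have "z(v := \<not> z v) \<in> states (nodes N)"
      using that lower_subset assms by (auto intro: states_fun_upd)
    moreover have "restrict (z(v := \<not> z v)) I = (restrict z I)(v := \<not> z v)"
      "restrict (z(v := \<not> z v)) J = restrict z J"
      using that by (auto simp: fun_eq_iff restrict_def)
    ultimately show ?thesis using eq by metis
  qed
  have high: "z' = z(v := \<not> z v) \<longleftrightarrow>
      restrict z I = restrict z' I \<and> restrict z' J = (restrict z J)(v := \<not> z v)"
    if "v \<in> J" for v
  proof -
    have "z(v := \<not> z v) \<in> states (nodes N)"
      using that assms by (auto intro: states_fun_upd)
    moreover have "restrict (z(v := \<not> z v)) J = (restrict z J)(v := \<not> z v)"
      "restrict (z(v := \<not> z v)) I = restrict z I"
      using that by (auto simp: fun_eq_iff restrict_def)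
    ultimately show ?thesis using eq by metis
  qed
  have "?low \<longleftrightarrow> (\<exists>v\<in>I. local_update N v z \<noteq> z v \<and> z' = z(v := \<not> z v))"
    unfolding transitions_iff nodes_subnetwork
    using restrict_in_states[of z I] low local_update_subnetwork[of _ z]
    by (metis (no_types, lifting) restrict_apply')
  moreover have "?high \<longleftrightarrow> (\<exists>v\<in>J. local_update N v z \<noteq> z v \<and> z' = z(v := \<not> z v))"
    unfolding transitions_iff nodes_fix_state
    using restrict_in_states[of z J] high local_update_fix_state[of _ z]
    by (metis (no_types, lifting) restrict_apply')
  moreover have "nodes N = I \<union> J" using lower_subset by blast
  ultimately show ?thesis
    using assms(1) unfolding transitions_iff[of z z' N] by blast
qed

lemma transition_lower:
  assumes "(x, x') \<in> transitions (subnetwork N I)" "y \<in> states J"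
  shows "(glue I x y, glue I x' y) \<in> transitions N"
proof -
  have "x \<in> states I" "x' \<in> states I"
    using transitions_in_states[OF assms(1)] by simp_all
  then show ?thesis
    using assms lower_subset
    by (simp add: transitions_decompose glue_in_states restrict_glue_lower restrict_glue_upper)
qed

lemma transition_upper:
  assumes "(y, y') \<in> transitions (fix_state N I x)" "x \<in> states I"
  shows "(glue I x y, glue I x y') \<in> transitions N"
proof -
  have "y \<in> states J" "y' \<in> states J"
    using transitions_in_states[OF assms(1)] by simp_all
  then show ?thesis
    using assms lower_subset
    by (simp add: transitions_decompose glue_in_states restrict_glue_lower restrict_glue_upper)
qed

lemma transition_cases:
  assumes "(z, z') \<in> transitions N"
  obtains (lower) "(restrict z I, restrict z' I) \<in> transitions (subnetwork N I)"
      "restrict z J = restrict z' J"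
    | (upper) "restrict z I = restrict z' I"
      "(restrict z J, restrict z' J) \<in> transitions (fix_state N I (restrict z I))"
  using assms transitions_decompose transitions_in_states[OF assms] by blast

section \<open>Attractors of a network split into two layers\<close>

lemma path_lower:
  assumes "(x, x') \<in> (transitions (subnetwork N I))\<^sup>*" "y \<in> states J"
  shows "(glue I x y, glue I x' y) \<in> (transitions N)\<^sup>*"
  using assms by induction (auto intro: transition_lower rtrancl_into_rtrancl)

text \<open>Closure is checked separately for the two kinds of transition. For connectedness, a path
  of \<open>fix_states N I a\<close> is lifted to \<open>N\<close>, with a move of the
  \<open>I\<close>-part before each step to an assignment that permits the step.\<close>

lemma state_product_in_attractors:
  assumes a: "a \<in> attractors (subnetwork N I)" and b: "b \<in> attractors (fix_states N I a)"
  shows "state_product (nodes N) I a b \<in> attractors N" (is "?P \<in> _")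
  unfolding attractors_iff
proof (intro conjI ballI allI impI)
  have sa: "a \<subseteq> states I" and sb: "b \<subseteq> states J"
    using attractors_subset_states[OF a] attractors_subset_states[OF b] by simp_all
  show "?P \<noteq> {}"
    using state_product_projections(1)[OF lower_subset sa sb] attractors_nonempty[OF a]
      attractors_nonempty[OF b] by auto
  show "?P \<subseteq> states (nodes N)" by (auto simp: state_product_def)
  show "z' \<in> ?P" if z: "z \<in> ?P" and t: "(z, z') \<in> transitions N" for z z'
    using t
  proof (cases rule: transition_cases)
    case lower
    then show ?thesis
      using z transitions_in_states[OF t] attractors_closed[OF a]
      by (auto simp: state_product_def)
  next
    case upper
    then have "(restrict z J, restrict z' J) \<in> transitions (fix_states N I a)"
      using z unfolding ASTG_fix_states by (auto simp: state_product_def)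
    with upper show ?thesis
      using z transitions_in_states[OF t] attractors_closed[OF b]
      by (auto simp: state_product_def)
  qed
  fix z z' assume "z \<in> ?P" "z' \<in> ?P"
  then have st: "z \<in> states (nodes N)" "z' \<in> states (nodes N)"
    and za: "restrict z I \<in> a" "restrict z' I \<in> a" and zb: "restrict z J \<in> b" "restrict z' J \<in> b"
    by (auto simp: state_product_def)
  \<comment> \<open>The lower end point \<open>x'\<close> is left arbitrary: the induction
    hypothesis is used with the \<open>x\<close> that permits the last upper step, and afterwards
    \<open>x\<close> is moved to \<open>x'\<close> within \<open>a\<close>.\<close>
  have "(glue I (restrict z I) (restrict z J), glue I x' y') \<in> (transitions N)\<^sup>*"
    if "(restrict z J, y') \<in> (transitions (fix_states N I a))\<^sup>*" "x' \<in> a" for x' y'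
    using that
  proof (induction arbitrary: x')
    case base
    then show ?case
      using path_lower attractors_connected[OF a] za(1) restrict_in_states by blast
  next
    case (step y y')
    from step.hyps(2) obtain x where x: "x \<in> a" "(y, y') \<in> transitions (fix_state N I x)"
      unfolding ASTG_fix_states by blast
    have "y' \<in> states J" using transitions_in_states[OF step.hyps(2)] by simp
    then have "(glue I x y', glue I x' y') \<in> (transitions N)\<^sup>*"
      using path_lower attractors_connected[OF a x(1) step.prems] by blast
    moreover have "(glue I x y, glue I x y') \<in> transitions N"
      using x sa by (auto intro: transition_upper)
    ultimately show ?case using step.IH[OF x(1)] by simp
  qed
  then show "(z, z') \<in> (transitions N)\<^sup>*"
    using attractors_connected[OF b zb] za(2) glue_restrict[OF st(1), of I]
      glue_restrict[OF st(2), of I] by metis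
qed

text \<open>Lower transitions lift to \<open>N\<close> with the \<open>J\<close>-part frozen, which
  gives closure. Conversely, a path in \<open>A\<close> projects to a path on \<open>I\<close>, its
  upper steps becoming stationary.\<close>

lemma attractor_projection_lower:
  assumes A: "A \<in> attractors N"
  shows "(\<lambda>z. restrict z I) ` A \<in> attractors (subnetwork N I)" (is "?a \<in> _")
  unfolding attractors_iff
proof (intro conjI ballI allI impI)
  show "?a \<noteq> {}" using attractors_nonempty[OF A] by simp
  show "?a \<subseteq> states (nodes (subnetwork N I))" by (auto simp: restrict_in_states)
next
  fix x x' assume "x \<in> ?a" and t: "(x, x') \<in> transitions (subnetwork N I)"
  then obtain z where z: "z \<in> A" "x = restrict z I" by blast
  then have g: "z = glue I x (restrict z J)"
    using attractors_subset_states[OF A] glue_restrict by (metis subsetD)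
  have "glue I x' (restrict z J) \<in> A"
    using attractors_closed[OF A z(1)] transition_lower[OF t restrict_in_states] g by metis
  moreover have "restrict (glue I x' (restrict z J)) I = x'"
    using restrict_glue_lower[OF lower_subset _ restrict_in_states] transitions_in_states[OF t]
    by simp
  ultimately show "x' \<in> ?a" by (metis imageI)
next
  fix x x' assume "x \<in> ?a" "x' \<in> ?a"
  then obtain z z' where z: "z \<in> A" "z' \<in> A" "x = restrict z I" "x' = restrict z' I" by blast
  have "(restrict z I, restrict z' I) \<in> (transitions (subnetwork N I))\<^sup>*"
    using attractors_connected[OF A z(1,2)]
  proof induction
    case (step w w')
    from step.hyps(2) show ?case
    proof (cases rule: transition_cases)
      case lower
      show ?thesis using step.IH lower(1) by (rule rtrancl_into_rtrancl)
    next
      case upper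
      show ?thesis using step.IH unfolding upper(1) .
    qed
  qed simp
  then show "(x, x') \<in> (transitions (subnetwork N I))\<^sup>*" using z by simp
qed

lemma attractor_is_state_product:
  assumes A: "A \<in> attractors N"
  shows "A = state_product (nodes N) I ((\<lambda>z. restrict z I) ` A) ((\<lambda>z. restrict z J) ` A)"
    (is "A = ?P")
proof
  show "A \<subseteq> ?P"
    using attractors_subset_states[OF A] by (auto simp: state_product_def)
  show "?P \<subseteq> A"
  proof
    fix z assume "z \<in> ?P"
    then obtain w w' where w: "w \<in> A" "w' \<in> A" "restrict z I = restrict w I"
      "restrict z J = restrict w' J" and z: "z \<in> states (nodes N)"
      by (auto simp: state_product_def)
    \<comment> \<open>\<open>w'\<close> already has the \<open>J\<close>-part of \<open>z\<close>,
      so it is enough to move its \<open>I\<close>-part to that of \<open>w\<close>. Closure of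
      \<open>A\<close> under transitions then yields \<open>z\<close>.\<close>
    have "(restrict w' I, restrict w I) \<in> (transitions (subnetwork N I))\<^sup>*"
      using attractors_connected[OF attractor_projection_lower[OF A]] w by blast
    then have "(glue I (restrict w' I) (restrict w' J), glue I (restrict w I) (restrict w' J))
        \<in> (transitions N)\<^sup>*"
      using path_lower restrict_in_states by blast
    moreover have "glue I (restrict w' I) (restrict w' J) = w'"
      using attractors_subset_states[OF A] w(2) glue_restrict by blast
    moreover have "glue I (restrict w I) (restrict w' J) = z"
      using glue_restrict[OF z, of I] w by simp
    ultimately have "(w', z) \<in> (transitions N)\<^sup>*" by simp
    then show "z \<in> A"
      by induction (use w attractors_closed[OF A] in auto)
  qed
qed

text \<open>A path in \<open>A\<close> projects to \<open>J\<close>, where lower steps become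
  stationary and upper steps are permitted by an \<open>I\<close>-part in \<open>a\<close>. Closure
  relies on the product form of \<open>A\<close>.\<close>

lemma attractor_projection_upper:
  assumes A: "A \<in> attractors N"
  defines "a \<equiv> (\<lambda>z. restrict z I) ` A"
  shows "(\<lambda>z. restrict z J) ` A \<in> attractors (fix_states N I a)" (is "?b \<in> _")
  unfolding attractors_iff
proof (intro conjI ballI allI impI)
  show "?b \<noteq> {}" using attractors_nonempty[OF A] by simp
  show "?b \<subseteq> states (nodes (fix_states N I a))" by (auto simp: restrict_in_states)
next
  fix y y' assume y: "y \<in> ?b" and "(y, y') \<in> transitions (fix_states N I a)"
  then obtain x where x: "x \<in> a" and t: "(y, y') \<in> transitions (fix_state N I x)"
    unfolding ASTG_fix_states by blast
  have sx: "x \<in> states I" using x by (auto simp: a_def restrict_in_states)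
  have sy: "y \<in> states J" "y' \<in> states J" using transitions_in_states[OF t] by simp_all
  \<comment> \<open>\<open>x\<close> and \<open>y\<close> may come from different states of
    \<open>A\<close>; the product form allows their combination.\<close>
  have "glue I x y \<in> A"
    using attractor_is_state_product[OF A] x y sx sy lower_subset
    by (auto simp: state_product_def glue_in_states restrict_glue_lower restrict_glue_upper a_def)
  then have "glue I x y' \<in> A"
    using attractors_closed[OF A] transition_upper[OF t sx] by blast
  moreover have "restrict (glue I x y') J = y'"
    using restrict_glue_upper[OF lower_subset sx sy(2)] .
  ultimately show "y' \<in> ?b" by (metis imageI)
next
  fix y y' assume "y \<in> ?b" "y' \<in> ?b"
  then obtain z z' where z: "z \<in> A" "z' \<in> A" "y = restrict z J" "y' = restrict z' J" by blast
  \<comment> \<open>Membership in \<open>A\<close> is carried along so that the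
    \<open>I\<close>-part at every step is known to lie in \<open>a\<close>.\<close>
  have "z' \<in> A \<and> (restrict z J, restrict z' J) \<in> (transitions (fix_states N I a))\<^sup>*"
    using attractors_connected[OF A z(1,2)]
  proof induction
    case base
    then show ?case using z by simp
  next
    case (step w w')
    then have w: "w \<in> A" "w' \<in> A" using attractors_closed[OF A] by auto
    from step.hyps(2) show ?case
    proof (cases rule: transition_cases)
      case lower
      then show ?thesis using w(2) step.IH by metis
    next
      case upper
      then have "(restrict w J, restrict w' J) \<in> transitions (fix_states N I a)"
        unfolding ASTG_fix_states using w by (auto simp: a_def)
      then show ?thesis using w(2) step.IH rtrancl_into_rtrancl by metis
    qed
  qed
  then show "(y, y') \<in> (transitions (fix_states N I a))\<^sup>*" using z by simp
qed

text \<open>Projections recover the non-empty factors, whence injectivity. Surjectivity holds since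
  every attractor is the product of its projections.\<close>

theorem bij_betw_state_product_attractors:
  "bij_betw (\<lambda>(a, b). state_product (nodes N) I a b)
    (SIGMA a : attractors (subnetwork N I). attractors (fix_states N I a)) (attractors N)"
proof (rule bij_betw_imageI)
  show "inj_on (\<lambda>(a, b). state_product (nodes N) I a b)
    (SIGMA a : attractors (subnetwork N I). attractors (fix_states N I a))"
  proof (rule inj_onI, clarify)
    fix a b a' b'
    assume *: "a \<in> attractors (subnetwork N I)" "b \<in> attractors (fix_states N I a)"
      "a' \<in> attractors (subnetwork N I)" "b' \<in> attractors (fix_states N I a')"
      and eq: "state_product (nodes N) I a b = state_product (nodes N) I a' b'"
    have sub: "a \<subseteq> states I" "b \<subseteq> states J" "a' \<subseteq> states I" "b' \<subseteq> states J"
      using *[THEN attractors_subset_states] by simp_all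
    show "a = a' \<and> b = b'"
      using state_product_projections[OF lower_subset sub(1,2) *(1,2)[THEN attractors_nonempty]]
        state_product_projections[OF lower_subset sub(3,4) *(3,4)[THEN attractors_nonempty]] eq
      by simp
  qed
  show "(\<lambda>(a, b). state_product (nodes N) I a b) `
    (SIGMA a : attractors (subnetwork N I). attractors (fix_states N I a)) = attractors N"
  proof (intro equalityI subsetI)
    fix A assume A: "A \<in> attractors N"
    then show "A \<in> (\<lambda>(a, b). state_product (nodes N) I a b) `
      (SIGMA a : attractors (subnetwork N I). attractors (fix_states N I a))"
      using attractor_is_state_product[OF A] attractor_projection_lower[OF A]
        attractor_projection_upper[OF A] by (auto intro!: rev_image_eqI)
  qed (auto intro: state_product_in_attractors)
qed

end

section \<open>Induction over the list of layers\<close>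

lemma layer_product_Cons:
  "layer_product (I # Is) (a # as) =
    {x \<in> states (I \<union> \<Union> (set Is)). restrict x I \<in> a \<and> restrict x (\<Union> (set Is)) \<in> layer_product Is as}"
proof -
  have "restrict (restrict x (\<Union> (set Is))) (Is ! i) = restrict x (Is ! i)"
    if "i < length Is" for x :: "'a \<Rightarrow> bool" and i
  proof -
    have "Is ! i \<subseteq> \<Union> (set Is)" using that by (simp add: Union_upper)
    then show ?thesis by (simp add: Int_absorb1)
  qed
  then show ?thesis
    by (auto simp: layer_product_def restrict_in_states less_Suc_eq_0_disj)
qed

lemma layer_network_Cons:
  assumes "nodes N = I \<union> \<Union> (set Is)" "I \<inter> \<Union> (set Is) = {}" "length as < length Is"
  shows "layer_network N (I # Is) (a # as) = layer_network (fix_states N I a) Is as"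
proof -
  \<comment> \<open>If only one layer \<open>K\<close> remains, the left side is
    \<open>fix_states N I a\<close> itself while the right side induces it on \<open>K\<close>,
    which is its whole node set.\<close>
  have "subnetwork (fix_states N I a) (Is ! 0) = fix_states N I a" if "\<not> Suc 0 < length Is"
  proof -
    from that assms(3) obtain K where "Is = [K]" by (cases Is) auto
    then have "nodes (fix_states N I a) = Is ! 0" using assms by auto
    then show ?thesis
      using subnetwork_nodes[OF pair_wf_digraph_fix_states[of N I a]] by simp
  qed
  then show ?thesis
    using assms(3) by (cases as) (auto simp: layer_network_def fix_layers_def)
qed

text \<open>Only prefixes shorter than \<open>k\<close> are ever passed to the family, which matches
  the length condition of \<open>layer_network_Cons\<close>.\<close>

lemma dependent_sum_cong:
  assumes "\<And>as. length as < k \<Longrightarrow> F as = G as"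
  shows "dependent_sum k F = dependent_sum k G"
  using assms
proof (induction k arbitrary: F G)
  case (Suc k)
  have "dependent_sum k (\<lambda>as. F (a # as)) = dependent_sum k (\<lambda>as. G (a # as))" for a
    by (rule Suc.IH, rule Suc.prems) simp
  moreover have "F [] = G []" by (rule Suc.prems) simp
  ultimately show ?case by simp
qed simp

lemma dependent_sum_eq:
  "dependent_sum k F = {as. length as = k \<and> (\<forall>i < k. as ! i \<in> F (take i as))}"
proof (induction k arbitrary: F)
  case (Suc k)
  show ?case
  proof (rule set_eqI)
    fix as
    show "as \<in> dependent_sum (Suc k) F \<longleftrightarrow>
      as \<in> {as. length as = Suc k \<and> (\<forall>i < Suc k. as ! i \<in> F (take i as))}"
      by (cases as) (auto simp: Suc.IH image_iff less_Suc_eq_0_disj)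
  qed
qed simp

text \<open>Order is expressed by arcs rather than paths, a condition readily passed on to
  \<open>fix_states\<close>. The first layer is split off, and the remaining ones are handled in the
  network that depends on its attractor \<open>a\<close>.\<close>

lemma bij_betw_layer_product_attractors:
  assumes "pair_wf_digraph (net_graph N)"
    and "nodes N = \<Union> (set Is)"
    and "sorted_wrt (\<lambda>I J. I \<inter> J = {} \<and> parcs (net_graph N) \<inter> J \<times> I = {}) Is"
  shows "bij_betw (layer_product Is)
    (dependent_sum (length Is) (\<lambda>as. attractors (layer_network N Is as))) (attractors N)"
  using assms
proof (induction Is arbitrary: N)
  case Nil
  then have "attractors N = {states {}}" by (intro attractors_no_nodes) simp
  then show ?case by (simp add: bij_betw_def layer_product_def)
next
  case (Cons I Is)
  define U where "U = \<Union> (set Is)"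
  define D where "D = (\<lambda>a. dependent_sum (length Is)
    (\<lambda>as. attractors (layer_network (fix_states N I a) Is as)))"
  have V: "nodes N = I \<union> U" and disj: "I \<inter> U = {}" "nodes N - I = U"
    and noarc: "parcs (net_graph N) \<inter> U \<times> I = {}"
    using Cons.prems by (auto simp: U_def)
  interpret lower_layer N I
  proof (rule lower_layer.intro)
    show "pair_wf_digraph (net_graph N)" "I \<subseteq> nodes N" using Cons.prems by auto
    show "u \<in> I" if "(u, v) \<in> parcs (net_graph N)" "v \<in> I" for u v
      using that noarc V pair_wf_digraph.in_arcsD1[OF Cons.prems(1) that(1)] by blast
  qed
  have IH: "bij_betw (layer_product Is) (D a) (attractors (fix_states N I a))" for a
    unfolding D_def
  proof (rule Cons.IH)
    show "pair_wf_digraph (net_graph (fix_states N I a))" by (rule pair_wf_digraph_fix_states)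
    show "nodes (fix_states N I a) = \<Union> (set Is)" using disj by (simp add: U_def)
    have "sorted_wrt (\<lambda>I J. I \<inter> J = {} \<and> parcs (net_graph N) \<inter> J \<times> I = {}) Is"
      using Cons.prems by simp
    then show "sorted_wrt
      (\<lambda>K J. K \<inter> J = {} \<and> parcs (net_graph (fix_states N I a)) \<inter> J \<times> K = {}) Is"
      \<comment> \<open>The only arcs added by \<open>fix_states\<close> are loops, which cannot
        join disjoint layers.\<close>
      by (rule sorted_wrt_mono_rel[rotated]) (auto simp: fix_states_def pair_induce_def)
  qed
  let ?S = "SIGMA a : attractors (subnetwork N I). D a"
  \<comment> \<open>The induction hypothesis is applied in the fibre over each
    \<open>a\<close>.\<close>
  have "bij_betw (\<lambda>(a, as). (a, layer_product Is as)) ?S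
      (SIGMA a : attractors (subnetwork N I). attractors (fix_states N I a))"
  proof (rule bij_betw_imageI)
    show "inj_on (\<lambda>(a, as). (a, layer_product Is as)) ?S"
      using inj_onD[OF bij_betw_imp_inj_on[OF IH]] by (auto intro!: inj_onI)
    show "(\<lambda>(a, as). (a, layer_product Is as)) ` ?S =
        (SIGMA a : attractors (subnetwork N I). attractors (fix_states N I a))"
      unfolding bij_betw_imp_surj_on[OF IH, symmetric] by force
  qed
  from bij_betw_trans[OF this bij_betw_state_product_attractors]
  have "bij_betw (\<lambda>(a, as). state_product (nodes N) I a (layer_product Is as)) ?S (attractors N)"
    by (simp add: comp_def case_prod_unfold)
  moreover have "layer_product (I # Is) (a # as) = state_product (nodes N) I a (layer_product Is as)"
    for a as
    using V disj by (simp add: layer_product_Cons state_product_def U_def)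
  ultimately have "bij_betw (layer_product (I # Is) \<circ> (\<lambda>(a, as). a # as)) ?S (attractors N)"
    by (simp add: comp_def case_prod_unfold)
  moreover have "bij_betw (\<lambda>(a, as). a # as) ?S ((\<lambda>(a, as). a # as) ` ?S)"
    by (auto intro!: bij_betw_imageI inj_onI)
  \<comment> \<open>Prepending \<open>a\<close> to \<open>as\<close> is a bijection onto its image,
    so it can be cancelled from the composition.\<close>
  ultimately have "bij_betw (layer_product (I # Is)) ((\<lambda>(a, as). a # as) ` ?S) (attractors N)"
    using bij_betw_comp_iff by blast
  moreover have "D a = dependent_sum (length Is)
      (\<lambda>as. attractors (layer_network N (I # Is) (a # as)))" for a
    unfolding D_def using V disj
    by (intro dependent_sum_cong) (simp add: layer_network_Cons U_def)
  moreover have "layer_network N (I # Is) [] = subnetwork N I"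
    by (simp add: layer_network_def)
  ultimately show ?case by simp
qed

theorem theorem8:
  fixes N :: "'v network" and Is :: "'v set list"
  assumes "pair_fin_digraph (net_graph N)"
    and "partition_on (nodes N) (set Is)" and "distinct Is"
    and "\<And>i j u v. i < j \<Longrightarrow> j < length Is \<Longrightarrow> u \<in> Is ! j \<Longrightarrow> v \<in> Is ! i \<Longrightarrow>
           \<not> u \<rightarrow>\<^sup>*\<^bsub>with_proj (net_graph N)\<^esub> v"
  shows "attractors N =
           {layer_product Is as | as. length as = length Is \<and>
              (\<forall>i < length Is. as ! i \<in> attractors (layer_network N Is (take i as)))}
       \<and> bij_betw (layer_product Is)
           (dependent_sum (length Is) (\<lambda>as. attractors (layer_network N Is as)))
           (attractors N)"
proof -
  interpret G: pair_fin_digraph "net_graph N" by (fact assms(1))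
  have "sorted_wrt (\<lambda>I J. I \<inter> J = {} \<and> parcs (net_graph N) \<inter> J \<times> I = {}) Is"
    unfolding sorted_wrt_iff_nth_less
  proof (intro allI impI conjI)
    fix i j assume ij: "i < j" "j < length Is"
    \<comment> \<open>The partition concerns the set of layers; distinctness turns different
      positions into different blocks.\<close>
    then have "Is ! i \<noteq> Is ! j" using assms(3) by (simp add: nth_eq_iff_index_eq)
    then show "Is ! i \<inter> Is ! j = {}"
      using partition_onD2[OF assms(2)] ij by (auto simp: disjoint_def)
    \<comment> \<open>An arc is a path of length one, so the path hypothesis excludes backward
      arcs.\<close>
    have "u \<rightarrow>\<^sup>*\<^bsub>with_proj (net_graph N)\<^esub> v" if "(u, v) \<in> parcs (net_graph N)" for u v
      using that by (intro G.reachable_adjI) simp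
    then show "parcs (net_graph N) \<inter> Is ! j \<times> Is ! i = {}"
      using assms(4)[OF ij] by blast
  qed
  then have bij: "bij_betw (layer_product Is)
      (dependent_sum (length Is) (\<lambda>as. attractors (layer_network N Is as))) (attractors N)"
    using G.pair_wf_digraph_axioms partition_onD1[OF assms(2)]
    by (intro bij_betw_layer_product_attractors)
  then have "attractors N = layer_product Is `
      dependent_sum (length Is) (\<lambda>as. attractors (layer_network N Is as))"
    by (simp add: bij_betw_def)
  also have "\<dots> = {layer_product Is as | as. length as = length Is \<and>
      (\<forall>i < length Is. as ! i \<in> attractors (layer_network N Is (take i as)))}"
    by (auto simp: dependent_sum_eq)
  finally show ?thesis using bij by (rule conjI)
qed

end
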